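(* Let $M$ be a Puiseux monoid. If $0$ is not a limit point of $M^\bullet$, then $M$ is a BFM and hence is atomic.
   Context: A Puiseux monoid is an additive submonoid $M$ of $\mathbb{Q}_{\ge 0}$; $M^\bullet := M\setminus\{0\}$. Limit points are taken in $\mathbb{R}$ with the usual topology. An element $a \in M^\bullet$ is an atom if $a = x+y$ with $x,y \in M$ implies $x=0$ or $y=0$; $M$ is atomic if each nonzero element is a (finite) sum of atoms. A factorization of $x \in M$ is a finite multiset of atoms of $M$ with sum $x$; its length is the number of atoms counted with multiplicity; $\mathsf{L}(x)$ is the set of lengths of all factorizations of $x$. $M$ is a BFM (bounded factorization monoid) if $M$ is atomic and $|\mathsf{L}(x)| < \infty$ for all $x \in M$. *)

theory Defs
  imports "HOL-Analysis.Analysis" "HOL-Library.Multiset"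
begin

definition puiseux_monoid :: "rat set \<Rightarrow> bool" where
  "puiseux_monoid M \<longleftrightarrow>
     (\<forall>x\<in>M. 0 \<le> x) \<and> 0 \<in> M \<and> (\<forall>x\<in>M. \<forall>y\<in>M. x + y \<in> M)"

definition atoms :: "rat set \<Rightarrow> rat set" where
  "atoms M = {a \<in> M - {0}. \<forall>x\<in>M. \<forall>y\<in>M. a = x + y \<longrightarrow> x = 0 \<or> y = 0}"

definition factorizations :: "rat set \<Rightarrow> rat \<Rightarrow> rat multiset set" where
  "factorizations M x = {F. set_mset F \<subseteq> atoms M \<and> \<Sum>\<^sub># F = x}"

definition lengths :: "rat set \<Rightarrow> rat \<Rightarrow> nat set" where
  "lengths M x = size ` factorizations M x"

(* A finite sum of atoms is the sum of a finite multiset of atoms. *)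
definition atomic_monoid :: "rat set \<Rightarrow> bool" where
  "atomic_monoid M \<longleftrightarrow> (\<forall>x \<in> M - {0}. \<exists>F. set_mset F \<subseteq> atoms M \<and> x = \<Sum>\<^sub># F)"

definition BFM :: "rat set \<Rightarrow> bool" where
  "BFM M \<longleftrightarrow> atomic_monoid M \<and> (\<forall>x\<in>M. finite (lengths M x))"

end

theory Submission
  imports Defs
begin

text \<open>
  If \<open>0\<close> is not a limit point of \<open>M - {0}\<close>, the nonzero elements of \<open>M\<close> are bounded below by some
  rational \<open>e > 0\<close>. Splitting off a nonzero summand therefore lowers an element by at least \<open>e\<close>, so
  repeated splitting stops at atoms, and a factorization of \<open>x\<close> has at most \<open>x / e\<close> atoms.
\<close>

lemma not_islimpt_zero_lower_bound:
  fixes S :: "rat set"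
  assumes nonneg: "\<And>x. x \<in> S \<Longrightarrow> 0 \<le> x"
    and "\<not> (0::real) islimpt (real_of_rat ` (S - {0}))"
  obtains e where "0 < e" and "\<And>x. x \<in> S \<Longrightarrow> x \<noteq> 0 \<Longrightarrow> e \<le> x"
proof -
  obtain d :: real where d: "0 < d"
    and far: "\<And>x. x \<in> S \<Longrightarrow> x \<noteq> 0 \<Longrightarrow> d \<le> \<bar>real_of_rat x\<bar>"
    using assms(2) unfolding islimpt_approachable by (auto simp: not_less)
  \<comment> \<open>The radius \<open>d\<close> is real; a rational below it keeps all later
    estimates inside \<open>rat\<close>.\<close>
  obtain e where e: "0 < real_of_rat e" "real_of_rat e < d"
    using of_rat_dense[OF d] by auto
  show thesis
  proof
    show "0 < e" using e(1) by simp
    fix x assume x: "x \<in> S" "x \<noteq> 0"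
    then have "real_of_rat e < real_of_rat x"
      using far[OF x] nonneg[OF x(1)] e(2) by simp
    then show "e \<le> x" by (simp add: of_rat_less)
  qed
qed

lemma atomic_monoid_if_lower_bound:
  assumes "0 < e" and e: "\<And>x. x \<in> M \<Longrightarrow> x \<noteq> 0 \<Longrightarrow> e \<le> x"
  shows "atomic_monoid M"
proof -
  \<comment> \<open>The order on nonnegative rationals is not well-founded, so the induction runs on
    a natural number \<open>n\<close> bounding \<open>x\<close> in units of \<open>e\<close>. For
    \<open>n = 0\<close> the claim is vacuous, since \<open>x\<close> is at least
    \<open>e > 0\<close>.\<close>
  have fact: "\<exists>F. set_mset F \<subseteq> atoms M \<and> x = \<Sum>\<^sub># F"
    if "x \<in> M" "x \<noteq> 0" "x \<le> of_nat n * e" for x n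
    using that
  proof (induction n arbitrary: x)
    case 0
    then show ?case using e[of x] \<open>0 < e\<close> by simp
  next
    case (Suc n)
    show ?case
    proof (cases "x \<in> atoms M")
      case True
      then show ?thesis by (intro exI[of _ "{#x#}"]) simp
    next
      case False
      then obtain y z where yz: "y \<in> M" "z \<in> M" "y \<noteq> 0" "z \<noteq> 0" "x = y + z"
        using Suc.prems by (auto simp: atoms_def)
      \<comment> \<open>Each summand is \<open>x\<close> minus the other one, which is at least
        \<open>e\<close>, so both fit under the bound for \<open>n\<close>.\<close>
      have "y \<le> of_nat n * e" "z \<le> of_nat n * e"
        using e[of y] e[of z] yz Suc.prems(3) by (auto simp: algebra_simps)
      then obtain F G where "set_mset F \<subseteq> atoms M" "y = \<Sum>\<^sub># F"
        and "set_mset G \<subseteq> atoms M" "z = \<Sum>\<^sub># G"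
        using Suc.IH[OF yz(1,3)] Suc.IH[OF yz(2,4)] by blast
      then show ?thesis using yz(5) by (intro exI[of _ "F + G"]) simp
    qed
  qed
  show ?thesis
    unfolding atomic_monoid_def
  proof
    fix x assume "x \<in> M - {0}"
    moreover obtain n where "x \<le> of_nat n * e"
      using ex_less_of_nat_mult[OF \<open>0 < e\<close>] less_imp_le by blast
    ultimately show "\<exists>F. set_mset F \<subseteq> atoms M \<and> x = \<Sum>\<^sub># F"
      using fact by blast
  qed
qed

lemma size_mult_le_sum_mset:
  fixes e :: "'a::linordered_semidom"
  assumes "\<And>a. a \<in># F \<Longrightarrow> e \<le> a"
  shows "of_nat (size F) * e \<le> \<Sum>\<^sub># F"
  using assms by (induction F) (auto simp: algebra_simps intro: add_mono)

lemma finite_lengths_if_lower_bound: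
  assumes "0 < e" and e: "\<And>x. x \<in> M \<Longrightarrow> x \<noteq> 0 \<Longrightarrow> e \<le> x"
  shows "finite (lengths M x)"
proof -
  \<comment> \<open>The Archimedean property gives one \<open>n\<close> that will bound the lengths
    of all factorizations of \<open>x\<close>.\<close>
  obtain n where n: "x < of_nat n * e"
    using ex_less_of_nat_mult[OF \<open>0 < e\<close>] by blast
  have "size F \<le> n" if "F \<in> factorizations M x" for F
  proof -
    \<comment> \<open>Atoms are nonzero elements of \<open>M\<close>, so each one contributes at
      least \<open>e\<close> to the sum \<open>x\<close>.\<close>
    have "of_nat (size F) * e \<le> x"
      using that e size_mult_le_sum_mset[of F e]
      by (auto simp: factorizations_def atoms_def)
    with n have "of_nat (size F) * e < of_nat n * e" by simp
    with \<open>0 < e\<close> show ?thesis by simp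
  qed
  then have "lengths M x \<subseteq> {..n}" by (auto simp: lengths_def)
  then show ?thesis by (rule finite_subset) simp
qed

theorem theorem4p7:
  fixes M :: "rat set"
  assumes "puiseux_monoid M"
    and "\<not> (0::real) islimpt (real_of_rat ` (M - {0}))"
  shows "BFM M \<and> atomic_monoid M"
proof -
  have "0 \<le> x" if "x \<in> M" for x
    using assms(1) that by (simp add: puiseux_monoid_def)
  then obtain e where e: "0 < e" "\<And>x. x \<in> M \<Longrightarrow> x \<noteq> 0 \<Longrightarrow> e \<le> x"
    using not_islimpt_zero_lower_bound[OF _ assms(2)] by metis
  show ?thesis
    using atomic_monoid_if_lower_bound[OF e] finite_lengths_if_lower_bound[OF e]
    by (simp add: BFM_def)
qed

end
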